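(* There exist recursively enumerable sets $A, B\subseteq\Sigma^*$ such that $A$ is $\mathrm{F}_{\mathrm{REC}}$-compressible to $B$ and $B$ is $\mathrm{F}_{\mathrm{REC}}$-compressible to $A$, yet $A$ and $B$ are not recursively isomorphic.
   Context: $\Sigma=\{0,1\}$. $A$ and $B$ are recursively isomorphic if there is a total recursive bijection $f:\Sigma^*\to\Sigma^*$ with $f(A)=B$. $\mathrm{F}_{\mathrm{REC}}$ is the class of total recursive functions from $\Sigma^*$ to $\Sigma^*$. Given $A,B\subseteq\Sigma^*$, a function $f$ is a compression function for $A$ to $B$ if $\mathrm{domain}(f)\supseteq A$, $f(A)=B$, and $f$ is injective on $A$; $A$ is $\mathrm{F}_{\mathrm{REC}}$-compressible to $B$ if some $f\in\mathrm{F}_{\mathrm{REC}}$ is a compression function for $A$ to $B$. *)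

theory Defs
  imports Main
begin

text \<open>
  Descriptions of partial recursive functions on the natural numbers. The relation
  \<open>rec_eval r xs y\<close> says that the function described by \<open>r\<close> is defined on the argument
  tuple \<open>xs\<close> and has the value \<open>y\<close>; absence of such a \<open>y\<close> means divergence (or an
  argument tuple of the wrong length).
\<close>

datatype recf =
    Zero
  | Succ
  | Proj nat
  | Comp recf "recf list"
  | PrimRec recf recf
  | Mu recf

inductive rec_eval :: "recf \<Rightarrow> nat list \<Rightarrow> nat \<Rightarrow> bool" where
  Zero: "rec_eval Zero xs 0"
| Succ: "rec_eval Succ [x] (Suc x)"
| Proj: "i < length xs \<Longrightarrow> rec_eval (Proj i) xs (xs ! i)"
| Comp: "list_all2 (\<lambda>g y. rec_eval g xs y) gs ys \<Longrightarrow> rec_eval f ys z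
    \<Longrightarrow> rec_eval (Comp f gs) xs z"
| PrimRec_0: "rec_eval f xs y \<Longrightarrow> rec_eval (PrimRec f g) (0 # xs) y"
| PrimRec_Suc: "rec_eval (PrimRec f g) (n # xs) y \<Longrightarrow> rec_eval g (n # y # xs) z
    \<Longrightarrow> rec_eval (PrimRec f g) (Suc n # xs) z"
| Mu: "rec_eval f (n # xs) 0 \<Longrightarrow> (\<And>m. m < n \<Longrightarrow> \<exists>y. rec_eval f (m # xs) (Suc y))
    \<Longrightarrow> rec_eval (Mu f) xs n"

inductive_cases rec_eval_ZeroE: "rec_eval Zero xs y"
inductive_cases rec_eval_SuccE: "rec_eval Succ xs y"
inductive_cases rec_eval_ProjE: "rec_eval (Proj i) xs y"
inductive_cases rec_eval_CompE: "rec_eval (Comp f gs) xs y"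
inductive_cases rec_eval_PrimRec_0E: "rec_eval (PrimRec f g) (0 # xs) y"
inductive_cases rec_eval_PrimRec_SucE: "rec_eval (PrimRec f g) (Suc n # xs) y"
inductive_cases rec_eval_MuE: "rec_eval (Mu f) xs y"

lemma rec_eval_functional:
  "rec_eval r xs y \<Longrightarrow> rec_eval r xs z \<Longrightarrow> y = z"
proof (induction r xs y arbitrary: z rule: rec_eval.induct)
  case (Comp xs gs ys f y)
  from Comp.prems obtain ys' where ys': "list_all2 (\<lambda>g y. rec_eval g xs y) gs ys'" "rec_eval f ys' z"
    by (rule rec_eval_CompE) auto
  have "ys = ys'"
    using Comp.IH(1) ys'(1) by (auto simp: list_all2_conv_all_nth intro!: nth_equalityI)
  with ys'(2) Comp.IH(2) show ?case by simp
next
  case (PrimRec_Suc f g n xs y z' z)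
  from PrimRec_Suc.prems obtain y' where
    "rec_eval (PrimRec f g) (n # xs) y'" "rec_eval g (n # y' # xs) z"
    by (rule rec_eval_PrimRec_SucE)
  with PrimRec_Suc.IH show ?case by metis
next
  case (Mu f n xs)
  from Mu.prems have z: "rec_eval f (z # xs) 0" "\<And>m. m < z \<Longrightarrow> \<exists>y. rec_eval f (m # xs) (Suc y)"
    by (auto elim: rec_eval_MuE)
  have "\<not> n < z"
    using z(2) Mu.IH(1) by fastforce
  moreover have "\<not> z < n"
    using z(1) Mu.IH(2) by fastforce
  ultimately show ?case by simp
qed (blast elim: rec_eval_ZeroE rec_eval_SuccE rec_eval_ProjE rec_eval_PrimRec_0E)+

text \<open>
  Words over \<open>{0, 1}\<close> are lists of Booleans. They are identified with the natural numbers
  via bijective base-2 notation (the digits 1 and 2 standing for the letters 0 and 1),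
  head of the list least significant.
\<close>

type_synonym word = "bool list"

fun word_code :: "word \<Rightarrow> nat" where
  "word_code [] = 0"
| "word_code (b # w) = 2 * word_code w + (if b then 2 else 1)"

lemma word_code_inj: "word_code v = word_code w \<Longrightarrow> v = w"
proof (induction v arbitrary: w)
  case Nil
  then show ?case by (cases w) (auto split: if_splits)
next
  case (Cons b v)
  then obtain c w' where w: "w = c # w'" by (cases w) (auto split: if_splits)
  from Cons.prems have "b = c \<and> word_code v = word_code w'"
    unfolding w by (cases b; cases c) (simp; presburger)+
  with Cons.IH w show ?case by simp
qed

lemma word_code_surj: "\<exists>w. word_code w = n"
proof (induction n rule: less_induct)
  case (less n)
  show ?case
  proof (cases "n = 0")
    case True
    then have "word_code [] = n" by simp
    then show ?thesis ..
  next
    case False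
    then have "(n - 1) div 2 < n" by presburger
    then obtain w where w: "word_code w = (n - 1) div 2" using less by blast
    have "word_code (even n # w) = n"
      using False w by (cases "even n") (simp; presburger)+
    then show ?thesis ..
  qed
qed

lemma bij_word_code: "bij word_code"
  unfolding bij_def inj_def surj_def using word_code_inj word_code_surj by metis

definition partial_recursive :: "(word \<rightharpoonup> word) \<Rightarrow> bool" where
  "partial_recursive f \<longleftrightarrow>
     (\<exists>r. \<forall>w v. rec_eval r [word_code w] (word_code v) \<longleftrightarrow> f w = Some v)"

definition recursively_enumerable :: "word set \<Rightarrow> bool" where
  "recursively_enumerable A \<longleftrightarrow> (\<exists>f. partial_recursive f \<and> dom f = A)"

definition F_REC :: "(word \<rightharpoonup> word) set" where
  "F_REC = {f. partial_recursive f \<and> dom f = UNIV}"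

definition compression_function :: "(word \<rightharpoonup> word) \<Rightarrow> word set \<Rightarrow> word set \<Rightarrow> bool" where
  "compression_function f A B \<longleftrightarrow> A \<subseteq> dom f \<and> f ` A = Some ` B \<and> inj_on f A"

definition compressible :: "(word \<rightharpoonup> word) set \<Rightarrow> word set \<Rightarrow> word set \<Rightarrow> bool" where
  "compressible F A B \<longleftrightarrow> (\<exists>f\<in>F. compression_function f A B)"

definition recursively_isomorphic :: "word set \<Rightarrow> word set \<Rightarrow> bool" where
  "recursively_isomorphic A B \<longleftrightarrow>
     (\<exists>f. (\<lambda>w. Some (f w)) \<in> F_REC \<and> bij f \<and> f ` A = B)"

end

theory Submission
  imports Defs
begin

text \<open>
  Take \<open>A = \<Sigma>\<^sup>*\<close> and \<open>B = \<Sigma>\<^sup>* - {\<epsilon>}\<close>. On codes, the successor compresses \<open>A\<close> to \<open>B\<close> and the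
  predecessor compresses \<open>B\<close> to \<open>A\<close>, since injectivity is only required on the source set;
  but a permutation of \<open>\<Sigma>\<^sup>*\<close> maps \<open>\<Sigma>\<^sup>*\<close> onto itself.
\<close>

definition code_word :: "nat \<Rightarrow> word" where
  "code_word = inv word_code"

lemma word_code_code_word [simp]: "word_code (code_word n) = n"
  unfolding code_word_def using bij_word_code by (simp add: bij_is_surj surj_f_inv_f)

lemma code_word_word_code [simp]: "code_word (word_code w) = w"
  unfolding code_word_def using bij_word_code by (simp add: bij_is_inj)

lemma code_word_0 [simp]: "code_word 0 = []"
  using code_word_word_code[of "[]"] by simp

lemma word_code_pos: "w \<noteq> [] \<Longrightarrow> 0 < word_code w"
  by (cases w) auto

lemma code_word_Suc_neq_Nil [simp]: "code_word (Suc n) \<noteq> []"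
  by (metis nat.distinct(1) word_code.simps(1) word_code_code_word)

text \<open>The converse implication in \<open>partial_recursive_def\<close> comes for free:
  \<open>rec_eval\<close> is single-valued and \<open>word_code\<close> is injective.\<close>

lemma partial_recursiveI:
  assumes "\<And>w v. f w = Some v \<Longrightarrow> rec_eval r [word_code w] (word_code v)"
    and "\<And>w. f w = None \<Longrightarrow> \<nexists>y. rec_eval r [word_code w] y"
  shows "partial_recursive f"
  unfolding partial_recursive_def
proof (intro exI allI iffI)
  fix w v
  assume "rec_eval r [word_code w] (word_code v)"
  then show "f w = Some v"
    using assms by (metis not_None_eq rec_eval_functional word_code_inj)
qed (use assms in blast)

lemma F_REC_I:
  assumes "\<And>n. rec_eval r [n] (g n)"
  shows "(\<lambda>w. Some (code_word (g (word_code w)))) \<in> F_REC"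
  unfolding F_REC_def using assms by (auto intro!: partial_recursiveI[where r = r])

lemma recursively_enumerable_UNIV: "recursively_enumerable UNIV"
proof -
  have "(\<lambda>w. Some (code_word (word_code w))) \<in> F_REC"
    by (rule F_REC_I[where r = "Proj 0"]) (use rec_eval.Proj[of 0] in fastforce)
  then show ?thesis
    unfolding F_REC_def recursively_enumerable_def by blast
qed

text \<open>The step function receives the recursion index ahead of the previous value, so
  \<open>Proj 0\<close> yields \<open>n\<close> at \<open>Suc n\<close>.\<close>

lemma rec_eval_pred: "rec_eval (PrimRec Zero (Proj 0)) [n] (n - 1)"
proof (induction n)
  case 0
  show ?case by (simp add: rec_eval.Zero rec_eval.PrimRec_0)
next
  case (Suc n)
  then show ?case
    using rec_eval.PrimRec_Suc[OF Suc rec_eval.Proj[of 0]] by simp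
qed

text \<open>Zero is sent to 1 rather than 0 because \<open>Mu\<close> halts on value 0: the search
  must fail exactly on the code of \<open>[]\<close>.\<close>

definition is_zero_recf :: recf where
  "is_zero_recf = PrimRec (Comp Succ [Zero]) Zero"

lemma rec_eval_is_zero_recf: "rec_eval is_zero_recf [n] (if n = 0 then 1 else 0)"
proof (induction n)
  case 0
  have "rec_eval (Comp Succ [Zero]) [] (Suc 0)"
    by (rule rec_eval.Comp[where ys = "[0]"]) (auto intro: rec_eval.intros)
  then show ?case by (simp add: is_zero_recf_def rec_eval.PrimRec_0)
next
  case (Suc n)
  then show ?case
    using rec_eval.PrimRec_Suc[OF Suc[unfolded is_zero_recf_def] rec_eval.Zero]
    by (simp add: is_zero_recf_def)
qed

text \<open>The unbounded search ignores its search variable, so it stops at once or never.\<close>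

lemma recursively_enumerable_nonempty_words: "recursively_enumerable (- {[]})"
proof -
  let ?h = "Comp is_zero_recf [Proj 1]"
  \<comment> \<open>A successful search stops at 0, the code of \<open>[]\<close>.\<close>
  let ?f = "\<lambda>w :: word. if w = [] then None else Some ([] :: word)"
  have h: "rec_eval ?h [m, n] (if n = 0 then 1 else 0)" for m n
    by (rule rec_eval.Comp[OF _ rec_eval_is_zero_recf])
      (use rec_eval.Proj[of 1 "[m, n]"] in simp)
  have "partial_recursive ?f"
  proof (rule partial_recursiveI[where r = "Mu ?h"])
    fix w v
    assume "?f w = Some v"
    then have "w \<noteq> []" "v = []" by (auto split: if_splits)
    then show "rec_eval (Mu ?h) [word_code w] (word_code v)"
      using h[of 0 "word_code w"] word_code_pos[of w] by (auto intro: rec_eval.Mu)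
  next
    fix w
    assume "?f w = None"
    then have "w = []" by (auto split: if_splits)
    \<comment> \<open>On input 0 the body \<open>?h\<close> is constantly 1, whereas halting would
      require the value 0.\<close>
    then show "\<nexists>y. rec_eval (Mu ?h) [word_code w] y"
      using h rec_eval_functional by (fastforce elim: rec_eval_MuE)
  qed
  moreover have "dom ?f = - {[]}" by (auto simp: dom_def)
  ultimately show ?thesis unfolding recursively_enumerable_def by blast
qed

lemma compressible_UNIV_nonempty_words: "compressible F_REC UNIV (- {[]})"
  unfolding compressible_def
proof
  let ?f = "\<lambda>w. Some (code_word (Suc (word_code w)))"
  show "?f \<in> F_REC"
    by (rule F_REC_I) (rule rec_eval.Succ)
  have "w \<in> range (\<lambda>w. code_word (Suc (word_code w)))" if "w \<noteq> []" for w
  proof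
    \<comment> \<open>The preimage is the predecessor word; no truncation occurs, as
      \<open>word_code w\<close> is positive.\<close>
    show "w = code_word (Suc (word_code (code_word (word_code w - 1))))"
      using word_code_pos[OF that] by simp
  qed simp
  then have "range ?f = Some ` (- {[]})" by (auto simp: image_iff)
  moreover have "inj ?f"
    by (rule injI) (metis Suc_inject option.inject word_code_code_word word_code_inj)
  ultimately show "compression_function ?f UNIV (- {[]})"
    by (auto simp: compression_function_def)
qed

lemma compressible_nonempty_words_UNIV: "compressible F_REC (- {[]}) UNIV"
  unfolding compressible_def
proof
  let ?f = "\<lambda>w. Some (code_word (word_code w - 1))"
  show "?f \<in> F_REC"
    by (rule F_REC_I) (rule rec_eval_pred)
  have "Some w \<in> ?f ` (- {[]})" for w
    by (rule image_eqI[where x = "code_word (Suc (word_code w))"]) simp_all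
  then have "?f ` (- {[]}) = range Some" by auto
  \<comment> \<open>Truncated subtraction identifies only the codes 0 and 1, and 0 is excluded
    here.\<close>
  moreover have "inj_on ?f (- {[]})"
  proof (rule inj_onI)
    fix v w
    assume "v \<in> - {[]}" "w \<in> - {[]}" "?f v = ?f w"
    then have "word_code v - 1 = word_code w - 1" "0 < word_code v" "0 < word_code w"
      by (auto intro: word_code_pos dest: arg_cong[where f = word_code])
    then show "v = w" by (intro word_code_inj) simp
  qed
  ultimately show "compression_function ?f (- {[]}) UNIV"
    by (auto simp: compression_function_def)
qed

lemma not_recursively_isomorphic_UNIV: "B \<noteq> UNIV \<Longrightarrow> \<not> recursively_isomorphic UNIV B"
  by (auto simp: recursively_isomorphic_def bij_is_surj)

theorem theorem10:
  "\<exists>A B. recursively_enumerable A \<and> recursively_enumerable B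
     \<and> compressible F_REC A B \<and> compressible F_REC B A
     \<and> \<not> recursively_isomorphic A B"
proof (intro exI conjI)
  \<comment> \<open>Settling this conjunct first fixes both witnesses for the other four.\<close>
  show "\<not> recursively_isomorphic UNIV (- {[]})"
    by (rule not_recursively_isomorphic_UNIV) blast
qed (rule recursively_enumerable_UNIV recursively_enumerable_nonempty_words
    compressible_UNIV_nonempty_words compressible_nonempty_words_UNIV)+

end
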